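(* Let $F(x)=\sum_{n\geqslant 0}|\mathcal{I}_n(102,201)|\,x^n$. Then $$F(x)=\frac{-8x^4+18x^3-10x^2-8x+4+2(2x-1)(x^2-2x+2)\sqrt{(5x-1)(x-1)}}{4x(2x-1)(x-1)(x-2)^2},$$ where $\sqrt{(5x-1)(x-1)}$ denotes the formal power series square root of $1-6x+5x^2$ with constant term $1$.
   Context: For $n\in\mathbb N$, an inversion sequence of size $n$ is a sequence $\sigma=(\sigma_1,\dots,\sigma_n)\in\mathbb N^n$ with $\sigma_i<i$ for all $i$ (there is one, empty, inversion sequence of size $0$). An integer sequence contains a pattern $\rho$ (a finite integer sequence such as $102$ or $201$) if it has a subsequence order-isomorphic to $\rho$, and avoids $\rho$ otherwise. $\mathcal{I}_n(P)$ denotes the set of inversion sequences of size $n$ avoiding every pattern in $P$. *)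

theory Defs
  imports
    "HOL-Library.Sublist"
    "HOL-Computational_Algebra.Formal_Laurent_Series"
    Complex_Main
begin

definition order_isomorphic :: "'a::linorder list \<Rightarrow> 'b::linorder list \<Rightarrow> bool" where
  "order_isomorphic xs ys \<longleftrightarrow>
     length xs = length ys \<and>
     (\<forall>i<length xs. \<forall>j<length xs. xs ! i < xs ! j \<longleftrightarrow> ys ! i < ys ! j)"

definition contains_pattern :: "'a::linorder list \<Rightarrow> 'b::linorder list \<Rightarrow> bool" where
  "contains_pattern xs \<rho> \<longleftrightarrow> (\<exists>ys. subseq ys xs \<and> order_isomorphic ys \<rho>)"

text \<open>
  Lists are indexed from 0, so the condition that the \<open>i\<close>-th entry (counted from 1)
  is smaller than \<open>i\<close> reads \<open>\<sigma> ! i < i + 1\<close> here.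
\<close>

definition inversion_sequences :: "nat \<Rightarrow> nat list set" where
  "inversion_sequences n = {\<sigma>. length \<sigma> = n \<and> (\<forall>i<n. \<sigma> ! i < i + 1)}"

definition avoiding_inversion_sequences :: "nat \<Rightarrow> int list set \<Rightarrow> nat list set" where
  "avoiding_inversion_sequences n P =
     {\<sigma> \<in> inversion_sequences n. \<forall>\<rho>\<in>P. \<not> contains_pattern \<sigma> \<rho>}"

lemma finite_inversion_sequences: "finite (inversion_sequences n)"
proof (rule finite_subset)
  show "inversion_sequences n \<subseteq> {\<sigma>. set \<sigma> \<subseteq> {..<n} \<and> length \<sigma> = n}"
    by (fastforce simp: inversion_sequences_def in_set_conv_nth)
qed (simp add: finite_lists_length_eq)

lemma finite_avoiding_inversion_sequences: "finite (avoiding_inversion_sequences n P)"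
  by (simp add: avoiding_inversion_sequences_def finite_inversion_sequences)

definition avoiding_gf :: "int list set \<Rightarrow> real fps" where
  "avoiding_gf P = Abs_fps (\<lambda>n. of_nat (card (avoiding_inversion_sequences n P)))"

text \<open>
  For a power series with constant term 1, \<open>fps_radical root 2\<close> is the square root with
  constant term 1; the two lemmas below confirm this for the series that is needed.
\<close>

abbreviation fps_sqrt :: "real fps \<Rightarrow> real fps" where
  "fps_sqrt f \<equiv> fps_radical root 2 f"

lemma fps_sqrt_power2:
  assumes "f $ 0 = 1"
  shows "(fps_sqrt f)\<^sup>2 = f" and "fps_sqrt f $ 0 = 1"
  using assms power_radical[of f root 1] by (auto simp: numeral_2_eq_2)

lemma fps_sqrt_unique:
  assumes "f $ 0 = 1" and "s\<^sup>2 = f" and "s $ 0 = 1"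
  shows "s = fps_sqrt f"
proof -
  have "s = fps_sqrt f \<or> s = - fps_sqrt f"
    using fps_sqrt_power2(1)[OF assms(1)] assms(2) by (metis power2_eq_iff)
  moreover have "s \<noteq> - fps_sqrt f"
  proof
    assume "s = - fps_sqrt f"
    then have "s $ 0 = - (fps_sqrt f $ 0)" by simp
    then show False using fps_sqrt_power2(2)[OF assms(1)] assms(3) by simp
  qed
  ultimately show ?thesis by blast
qed

end

theory Submission
  imports Defs
begin

text \<open>
  A sequence avoids 102 and 201 iff, for every entry, all larger entries before and after it
  are equal whenever both kinds exist. Cut a nonzero avoiding sequence with maximum \<open>m\<close> at the
  first and the last occurrence of \<open>m\<close>: the part before is weakly increasing, the part after is
  weakly decreasing, and the middle uses, besides \<open>m\<close>, at most one further value \<open>b\<close>, which then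
  bounds both outer parts. Put \<open>b = m - 1\<close> if the middle is constant, and let \<open>b + d + 1\<close> be
  the length of the first part. Then the outer parts depend on \<open>b\<close> and \<open>d\<close> only, and the
  generating function of the middle parts depends on \<open>d\<close> only.

  Let \<open>G d\<close> be the series of the outer parts summed over \<open>b\<close>, up to a shift and a factor
  \<open>y = 1/(1 - x)\<close>. Removing the last entry of the first part (a ballot path step) gives
  \<open>G 0 = 1 + y G 1\<close> and \<open>G (d+1) = y G (d+2) + x G d\<close>, whence \<open>x G d = c^(d+1)\<close> where
  \<open>c = x + y c\<^sup>2\<close>, that is \<open>c = (1 - x - sqrt ((1 - 5x)(1 - x))) / 2\<close>. The sum over \<open>d\<close>
  is geometric.
\<close>

section \<open>Structure of the avoiding sequences\<close>

lemma append_eq_append_Cons_cases: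
  assumes "xs @ ys = l @ b # r"
  obtains r' where "xs = l @ b # r'" "r = r' @ ys" | l' where "ys = l' @ b # r" "l = xs @ l'"
  using assms by (auto simp: append_eq_append_conv2 append_eq_Cons_conv Cons_eq_append_conv)

lemma contains_pattern_3_iff:
  "contains_pattern xs [p, q, r] \<longleftrightarrow>
    (\<exists>u a v b w c t. xs = u @ a # v @ b # w @ c # t \<and> order_isomorphic [a, b, c] [p, q, r])"
proof
  assume "contains_pattern xs [p, q, r]"
  then obtain ys where ys: "subseq ys xs" "order_isomorphic ys [p, q, r]"
    by (auto simp: contains_pattern_def)
  then have "length ys = 3" by (simp add: order_isomorphic_def)
  then obtain a b c where "ys = [a, b, c]"
    by (auto simp: numeral_3_eq_3 length_Suc_conv)
  with ys show "\<exists>u a v b w c t. xs = u @ a # v @ b # w @ c # t \<and> order_isomorphic [a, b, c] [p, q, r]"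
    by (fastforce dest!: list_emb_ConsD)
next
  assume "\<exists>u a v b w c t. xs = u @ a # v @ b # w @ c # t \<and> order_isomorphic [a, b, c] [p, q, r]"
  then obtain u a v b w c t where xs: "xs = u @ a # v @ b # w @ c # t"
    and iso: "order_isomorphic [a, b, c] [p, q, r]" by blast
  have "subseq [a, b, c] xs"
    unfolding xs by (intro subseq_drop_many subseq_Cons2 list_emb_Nil)
  with iso show "contains_pattern xs [p, q, r]"
    by (auto simp: contains_pattern_def)
qed

lemma order_isomorphic_102: "order_isomorphic [a, b, c] [1, 0, 2 :: int] \<longleftrightarrow> b < a \<and> a < c"
  by (auto simp: order_isomorphic_def All_less_Suc)

lemma order_isomorphic_201: "order_isomorphic [a, b, c] [2, 0, 1 :: int] \<longleftrightarrow> b < c \<and> c < a"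
  by (auto simp: order_isomorphic_def All_less_Suc)

text \<open>Splitting the list at the valley \<open>b\<close> fits the later cuts at the maximum
  better than indices would.\<close>

definition valleys_flat :: "'a::linorder list \<Rightarrow> bool" where
  "valleys_flat xs \<longleftrightarrow>
    (\<forall>l b r. xs = l @ b # r \<longrightarrow> (\<forall>a\<in>set l. \<forall>c\<in>set r. b < a \<longrightarrow> b < c \<longrightarrow> a = c))"

lemma valleys_flat_iff_avoids:
  "valleys_flat xs \<longleftrightarrow> (\<forall>\<rho>\<in>{[1, 0, 2], [2, 0, 1 :: int]}. \<not> contains_pattern xs \<rho>)"
proof
  assume flat: "valleys_flat xs"
  have "a = c" if "xs = u @ a # v @ b # w @ c # t" "b < a" "b < c" for u a v b w c t
    using flat[unfolded valleys_flat_def, rule_format, of "u @ a # v" b "w @ c # t" a c] that by simp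
  then show "\<forall>\<rho>\<in>{[1, 0, 2], [2, 0, 1 :: int]}. \<not> contains_pattern xs \<rho>"
    by (fastforce simp: contains_pattern_3_iff order_isomorphic_102 order_isomorphic_201)
next
  assume avoids: "\<forall>\<rho>\<in>{[1, 0, 2], [2, 0, 1 :: int]}. \<not> contains_pattern xs \<rho>"
  show "valleys_flat xs"
    unfolding valleys_flat_def
  proof (intro allI impI ballI)
    fix l b r a c
    assume xs: "xs = l @ b # r" and a: "a \<in> set l" and c: "c \<in> set r" and "b < a" "b < c"
    from a obtain u v where "l = u @ a # v" by (auto simp: in_set_conv_decomp)
    moreover from c obtain w t where "r = w @ c # t" by (auto simp: in_set_conv_decomp)
    ultimately have "xs = u @ a # v @ b # w @ c # t" using xs by simp
    with avoids have "\<not> order_isomorphic [a, b, c] [1, 0, 2 :: int]"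
      "\<not> order_isomorphic [a, b, c] [2, 0, 1 :: int]"
      unfolding ball_simps contains_pattern_3_iff by blast+
    with \<open>b < a\<close> \<open>b < c\<close> show "a = c"
      by (auto simp: order_isomorphic_102 order_isomorphic_201)
  qed
qed

section \<open>The pieces of a sequence cut at its maximum\<close>

definition rising :: "nat \<Rightarrow> nat \<Rightarrow> nat list set" where
  "rising p w = {xs. length xs = p \<and> sorted xs \<and> (\<forall>i<p. xs ! i \<le> i) \<and> (\<forall>x\<in>set xs. x < w)}"

text \<open>The inversion condition is absent here: the last part starts beyond position
  \<open>m\<close> and its entries stay below \<open>m\<close>.\<close>

definition falling :: "nat \<Rightarrow> nat list set" where
  "falling w = {xs. sorted_wrt (\<ge>) xs \<and> (\<forall>x\<in>set xs. x < w)}"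

text \<open>Requiring \<open>b\<close> in \<open>u\<close> keeps these lists apart from the constant
  middles.\<close>

definition dipped :: "nat \<Rightarrow> nat \<Rightarrow> nat list set" where
  "dipped b m = {m # u @ [m] | u. set u \<subseteq> {b, m} \<and> b \<in> set u}"

text \<open>
  The upper bound on \<open>m\<close> is the inversion sequence condition at the first \<open>m\<close>, whose index
  (counted from 0) is \<open>b + d + 1\<close>.
\<close>

definition crests :: "nat \<Rightarrow> nat \<Rightarrow> nat list set" where
  "crests b d = {replicate (Suc k) (Suc b) | k. True} \<union> (\<Union>m\<in>{b+1..b+d+1}. dipped b m)"

text \<open>The last fact lets \<open>b\<close> be recovered from a constant middle, as needed for
  injectivity of \<open>glue\<close>.\<close>

lemma crestsE:
  assumes "mid \<in> crests b d"
  obtains m where "b < m" "m \<le> b + d + 1" "hd mid = m" "last mid = m" "mid \<noteq> []"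
    "set mid \<subseteq> {b, m}" "b \<notin> set mid \<Longrightarrow> m = Suc b"
proof -
  from assms consider k where "mid = replicate (Suc k) (Suc b)"
    | m where "m \<in> {b+1..b+d+1}" "mid \<in> dipped b m"
    by (auto simp: crests_def)
  then show thesis
  proof cases
    case 1
    then show thesis by (intro that[of "Suc b"]) (auto split: if_splits)
  next
    case 2
    then show thesis by (intro that[of m]) (auto simp: dipped_def)
  qed
qed

section \<open>Gluing is a bijection onto the nonzero avoiding sequences\<close>

lemma takeWhile_append_not_hd:
  "\<forall>x\<in>set xs. P x \<Longrightarrow> ys \<noteq> [] \<Longrightarrow> \<not> P (hd ys) \<Longrightarrow> takeWhile P (xs @ ys @ zs) = xs"
  by (cases ys) (auto simp: takeWhile_append2)

text \<open>Both \<open>m\<close> and \<open>m'\<close> are the maximum of the whole list. The outer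
  parts are then the maximal runs of smaller entries at its two ends.\<close>

lemma peak_decomposition_unique:
  fixes m :: "'a::linorder"
  assumes eq: "pre @ mid @ suf = pre' @ mid' @ suf'"
    and "\<forall>x\<in>set pre. x < m" "\<forall>x\<in>set suf. x < m" "\<forall>x\<in>set mid. x \<le> m"
      "mid \<noteq> []" "hd mid = m" "last mid = m"
    and "\<forall>x\<in>set pre'. x < m'" "\<forall>x\<in>set suf'. x < m'" "\<forall>x\<in>set mid'. x \<le> m'"
      "mid' \<noteq> []" "hd mid' = m'" "last mid' = m'"
  shows "pre = pre' \<and> mid = mid' \<and> suf = suf'"
proof -
  have "m = Max (set (pre @ mid @ suf))"
    using assms(2-7) hd_in_set[of mid] by (intro Max_eqI[symmetric]) auto
  moreover have "m' = Max (set (pre' @ mid' @ suf'))"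
    using assms(8-13) hd_in_set[of mid'] by (intro Max_eqI[symmetric]) auto
  ultimately have [simp]: "m' = m" using eq by simp
  have "pre = takeWhile (\<lambda>x. x < m) (pre @ mid @ suf)"
    using assms by (intro takeWhile_append_not_hd[symmetric]) auto
  also have "\<dots> = takeWhile (\<lambda>x. x < m) (pre' @ mid' @ suf')" by (simp only: eq)
  also have "\<dots> = pre'" using assms by (intro takeWhile_append_not_hd) auto
  finally have 1: "pre = pre'" .
  have "rev suf = takeWhile (\<lambda>x. x < m) (rev suf @ rev mid @ rev pre)"
    using assms by (intro takeWhile_append_not_hd[symmetric]) (auto simp: hd_rev)
  also have "\<dots> = takeWhile (\<lambda>x. x < m) (rev suf' @ rev mid' @ rev pre')"
    using arg_cong[OF eq, of rev] by simp
  also have "\<dots> = rev suf'" using assms by (intro takeWhile_append_not_hd) (auto simp: hd_rev)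
  finally have "suf = suf'" by simp
  with 1 eq show ?thesis by simp
qed

definition glue :: "nat \<times> nat \<times> nat list \<times> nat list \<times> nat list \<Rightarrow> nat list" where
  "glue = (\<lambda>(b, d, pre, mid, suf). pre @ mid @ suf)"

text \<open>Keeping \<open>b\<close> and \<open>d\<close> in the tuple, although the list determines
  them, turns the count into a double sum.\<close>

definition pieces :: "nat \<Rightarrow> (nat \<times> nat \<times> nat list \<times> nat list \<times> nat list) set" where
  "pieces n = {(b, d, pre, mid, suf). pre \<in> rising (b + d + 1) (b + 1) \<and> mid \<in> crests b d \<and>
     suf \<in> falling (b + 1) \<and> length pre + length mid + length suf = n}"

lemma inj_on_glue: "inj_on glue (pieces n)"
proof (rule inj_onI)
  fix s t assume "s \<in> pieces n" "t \<in> pieces n" and eq: "glue s = glue t"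
  obtain b d pre mid suf where s: "s = (b, d, pre, mid, suf)" by (cases s)
  obtain b' d' pre' mid' suf' where t: "t = (b', d', pre', mid', suf')" by (cases t)
  have A: "pre \<in> rising (b + d + 1) (b + 1)" "mid \<in> crests b d" "suf \<in> falling (b + 1)"
    using \<open>s \<in> pieces n\<close> by (auto simp: pieces_def s)
  have B: "pre' \<in> rising (b' + d' + 1) (b' + 1)" "mid' \<in> crests b' d'" "suf' \<in> falling (b' + 1)"
    using \<open>t \<in> pieces n\<close> by (auto simp: pieces_def t)
  obtain m where m: "b < m" "hd mid = m" "last mid = m" "mid \<noteq> []"
    "set mid \<subseteq> {b, m}" "b \<notin> set mid \<Longrightarrow> m = Suc b" using A(2) by (elim crestsE) blast
  obtain m' where m': "b' < m'" "hd mid' = m'" "last mid' = m'" "mid' \<noteq> []"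
    "set mid' \<subseteq> {b', m'}" "b' \<notin> set mid' \<Longrightarrow> m' = Suc b'" using B(2) by (elim crestsE) blast
  have *: "pre = pre' \<and> mid = mid' \<and> suf = suf'"
    by (rule peak_decomposition_unique[where m = m and m' = m'])
      (use A B m m' eq in \<open>auto simp: s t glue_def rising_def falling_def\<close>)
  then have [simp]: "m' = m" using m m' by simp
  have "b = b'"
  \<comment> \<open>Below \<open>m\<close> the middle can contain only \<open>b\<close>; if it
    contains nothing there, \<open>m = Suc b\<close>. Either way \<open>b\<close> is determined, and
    the length of \<open>pre\<close> then gives \<open>d\<close>.\<close>
  proof (cases "b \<in> set mid")
    case True
    then show ?thesis using * m m' by fastforce
  next
    case False
    then show ?thesis using * m m' by fastforce
  qed
  moreover have "d = d'" using * A(1) B(1) \<open>b = b'\<close> by (auto simp: rising_def)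
  ultimately show "s = t" using * by (simp add: s t)
qed

text \<open>A valley in \<open>pre\<close> has nothing larger before it, one in \<open>suf\<close>
  nothing larger after it. A valley in \<open>mid\<close> is at least \<open>b\<close>, so whatever
  exceeds it is \<open>m\<close>.\<close>

lemma valleys_flat_append3:
  assumes "sorted pre" "sorted_wrt (\<ge>) suf" "set mid \<subseteq> {b, m}" "b < m"
    "\<forall>x\<in>set pre. x \<le> b" "\<forall>x\<in>set suf. x \<le> b"
  shows "valleys_flat (pre @ mid @ suf)"
  unfolding valleys_flat_def
proof (intro allI impI ballI)
  fix l y r a c
  assume eq: "pre @ mid @ suf = l @ y # r" and ac: "a \<in> set l" "c \<in> set r" "y < a" "y < c"
  from eq show "a = c"
  proof (cases rule: append_eq_append_Cons_cases)
    case 1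
    then show ?thesis using assms(1) ac by (auto simp: sorted_append)
  next
    case (2 l')
    from 2(1) show ?thesis
    proof (cases rule: append_eq_append_Cons_cases)
      case (1 r')
      then have "y \<in> {b, m}" "a \<in> {b, m} \<or> a \<le> b" "c \<in> {b, m} \<or> c \<le> b"
        using assms(3,5,6) ac 2 by auto
      then show ?thesis using ac(3,4) assms(4) by auto
    next
      case 2
      then show ?thesis using assms(2) ac by (auto simp: sorted_wrt_append)
    qed
  qed
qed

text \<open>The last two claims separate the glued lists from the zero sequences; the empty list
  needs its own claim, its set being empty.\<close>

lemma glue_avoids:
  assumes "s \<in> pieces n"
  shows "glue s \<in> avoiding_inversion_sequences n {[1, 0, 2], [2, 0, 1]}" "set (glue s) \<noteq> {0}" "glue s \<noteq> []"
proof -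
  obtain b d pre mid suf where s: "s = (b, d, pre, mid, suf)" by (cases s)
  have A: "pre \<in> rising (b + d + 1) (b + 1)" "mid \<in> crests b d" "suf \<in> falling (b + 1)"
    "length pre + length mid + length suf = n"
    using \<open>s \<in> pieces n\<close> by (auto simp: pieces_def s)
  obtain m where m: "b < m" "m \<le> b + d + 1" "hd mid = m" "mid \<noteq> []"
    "set mid \<subseteq> {b, m}" using A(2) by (elim crestsE) blast
  have "valleys_flat (pre @ mid @ suf)"
    using A m by (intro valleys_flat_append3[of _ _ _ b m]) (auto simp: rising_def falling_def)
  moreover have "(pre @ mid @ suf) ! i < i + 1" if "i < n" for i
  proof (cases "i < length pre")
    case True
    then show ?thesis using A(1) by (auto simp: rising_def nth_append less_Suc_eq_le)
  next
    \<comment> \<open>From here on the position is at least \<open>length pre = b + d + 1\<close>,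
      which is at least \<open>m\<close> and so bounds every entry.\<close>
    case False
    have "(pre @ mid @ suf) ! i \<in> set (pre @ mid @ suf)" using that A(4) by (intro nth_mem) simp
    then have "(pre @ mid @ suf) ! i \<le> m"
      using A m by (auto simp: rising_def falling_def)
    then show ?thesis using False m A(1) by (auto simp: rising_def)
  qed
  ultimately show "glue s \<in> avoiding_inversion_sequences n {[1, 0, 2], [2, 0, 1]}"
    using A(4) unfolding avoiding_inversion_sequences_def inversion_sequences_def
      valleys_flat_iff_avoids[symmetric]
    by (auto simp: glue_def s)
  have "m \<in> set (glue s)" using hd_in_set[of mid] m by (simp add: glue_def s)
  with \<open>b < m\<close> show "set (glue s) \<noteq> {0}" "glue s \<noteq> []" by fastforce+
qed

text \<open>Throughout, an occurrence of \<open>m\<close> on one side of a smaller entry forces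
  every larger entry on the other side to equal \<open>m\<close>.\<close>

lemma avoiding_in_glue:
  assumes "xs \<in> avoiding_inversion_sequences n {[1, 0, 2], [2, 0, 1]}" "xs \<noteq> replicate n 0"
  shows "xs \<in> glue ` pieces n"
proof -
  have len: "length xs = n" and inv: "\<And>i. i < n \<Longrightarrow> xs ! i \<le> i" and flat: "valleys_flat xs"
    using assms(1) unfolding avoiding_inversion_sequences_def inversion_sequences_def
      valleys_flat_iff_avoids[symmetric] by (auto simp: less_Suc_eq_le)
  define m where "m = Max (set xs)"
  have "xs \<noteq> []" using assms(2) len by auto
  then have m: "m \<in> set xs" "\<And>x. x \<in> set xs \<Longrightarrow> x \<le> m" by (auto simp: m_def)
  have "m > 0"
  proof (rule ccontr)
    assume "\<not> m > 0"
    then have "\<forall>x\<in>set xs. x = 0" using m by auto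
    then show False using assms(2) len by (simp add: replicate_eqI)
  qed
  from m(1) obtain pre rest where xs1: "xs = pre @ m # rest" "m \<notin> set pre"
    by (auto dest: split_list_first)
  have pre_less: "x < m" if "x \<in> set pre" for x using m(2)[of x] that xs1 by (auto simp: le_less)
  have step: "a = c" if "xs = l @ b # r" "a \<in> set l" "c \<in> set r" "b < a" "b < c" for l b r a c
    using flat that unfolding valleys_flat_def by blast
  \<comment> \<open>A descent in \<open>pre\<close> would make its lower entry a valley with the
    first \<open>m\<close> to its right, forcing the upper entry to be \<open>m\<close>.\<close>
  have "sorted pre"
    unfolding sorted_wrt_iff_nth_less
  proof (intro allI impI)
    fix i j assume ij: "i < j" "j < length pre"
    show "pre ! i \<le> pre ! j"
    proof (rule ccontr)
      assume "\<not> pre ! i \<le> pre ! j"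
      moreover have "pre ! i \<in> set (take j pre)" using ij by (auto simp: in_set_conv_nth)
      moreover have "xs = take j pre @ pre ! j # drop (Suc j) pre @ m # rest"
        using ij by (simp add: xs1 id_take_nth_drop[of j pre, symmetric] del: append_Cons)
      ultimately have "pre ! i = m"
        using ij pre_less[of "pre ! j"] by (intro step[of "take j pre" "pre ! j"]) auto
      then show False using xs1 ij by auto
    qed
  qed
  define p where "p = length pre"
  have "m \<le> p" using inv[of p] len xs1 by (simp add: p_def)
  have pre_le: "pre ! i \<le> i" if "i < p" for i
    using inv[of i] that len xs1 by (auto simp: p_def nth_append)
  have riseI: "pre \<in> rising p w" if "\<And>x. x \<in> set pre \<Longrightarrow> x < w" for w
    using that \<open>sorted pre\<close> pre_le by (auto simp: rising_def p_def)
  \<comment> \<open>The middle ends at the last \<open>m\<close>, and is a single entry if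
    \<open>m\<close> occurs only once.\<close>
  obtain mid suf where xs2: "xs = pre @ mid @ suf" "m \<notin> set suf"
    and mid: "mid = [m] \<or> (\<exists>u. mid = m # u @ [m])"
  proof (cases "m \<in> set rest")
    case True
    then obtain u suf where "rest = u @ m # suf" "m \<notin> set suf" by (auto dest: split_list_last)
    then show thesis using xs1 by (intro that[of "m # u @ [m]" suf]) auto
  next
    case False
    then show thesis using xs1 by (intro that[of "[m]" rest]) auto
  qed
  have m_mid: "m \<in> set mid" using mid by auto
  have suf_less: "x < m" if "x \<in> set suf" for x using m(2)[of x] that xs2 by (auto simp: le_less)
  have "sorted_wrt (\<ge>) suf"
    unfolding sorted_wrt_iff_nth_less
  proof (intro allI impI)
    fix i j assume ij: "i < j" "j < length suf"
    show "suf ! j \<le> suf ! i"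
    proof (rule ccontr)
      assume "\<not> suf ! j \<le> suf ! i"
      moreover have "suf ! j \<in> set (drop (Suc i) suf)"
        using ij by (auto simp: in_set_conv_nth intro!: exI[of _ "j - Suc i"])
      moreover have "xs = (pre @ mid @ take i suf) @ suf ! i # drop (Suc i) suf"
        using ij id_take_nth_drop[of i suf] by (simp add: xs2)
      ultimately have "m = suf ! j"
        using ij suf_less[of "suf ! i"] m_mid
        by (intro step[of "pre @ mid @ take i suf" "suf ! i" "drop (Suc i) suf"]) auto
      then show False using xs2 ij by auto
    qed
  qed
  then have fallI: "suf \<in> falling w" if "\<And>x. x \<in> set suf \<Longrightarrow> x < w" for w
    using that by (auto simp: falling_def)
  have lens: "length pre + length mid + length suf = n" using len xs2 by simp
  show ?thesis
  proof (cases "set mid \<subseteq> {m}")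
    case True
    define b where "b = m - 1"
    have mb: "m = Suc b" using \<open>m > 0\<close> by (simp add: b_def)
    have p: "b + (p - m) + 1 = p" using \<open>m \<le> p\<close> mb by simp
    have "mid = replicate (length mid) m" using True by (intro replicate_eqI) auto
    moreover have "length mid = Suc (length mid - 1)" using mid by auto
    ultimately have "mid = replicate (Suc (length mid - 1)) (Suc b)" using mb by metis
    then have "mid \<in> crests b (p - m)" unfolding crests_def by blast
    moreover have "pre \<in> rising p (b + 1)" using mb pre_less by (intro riseI) auto
    moreover have "suf \<in> falling (b + 1)" using mb suf_less by (intro fallI) auto
    ultimately have "(b, p - m, pre, mid, suf) \<in> pieces n"
      using lens by (simp add: pieces_def p del: One_nat_def)
    then show ?thesis by (rule rev_image_eqI) (simp add: glue_def xs2)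
  next
    case False
    then obtain u where u: "mid = m # u @ [m]" using mid by auto
    \<comment> \<open>Any entry of \<open>mid\<close> other than \<open>m\<close> will do as
      \<open>b\<close>: all such entries turn out to be equal.\<close>
    from False obtain b where b: "b \<in> set mid" "b \<noteq> m" by auto
    have b_u: "b \<in> set u" using u b by auto
    have "b < m" using m(2)[of b] b xs2 by (auto simp: le_less)
    from b_u obtain u1 u2 where u12: "u = u1 @ b # u2" by (auto simp: in_set_conv_decomp)
    define l where "l = pre @ m # u1"
    define r where "r = u2 @ m # suf"
    have xs3: "xs = l @ b # r" by (simp add: l_def r_def xs2 u u12)
    have lb: "a \<le> b \<or> a = m" if "a \<in> set l" for a
      using step[OF xs3 that, of m] \<open>b < m\<close> by (cases "b < a") (auto simp: r_def)
    have rb: "c \<le> b \<or> c = m" if "c \<in> set r" for c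
      using step[OF xs3 _ that, of m] \<open>b < m\<close> by (cases "b < c") (auto simp: l_def)
    \<comment> \<open>By \<open>lb\<close> and \<open>rb\<close> a third value lies below
      \<open>b\<close>. It would then be a valley between an \<open>m\<close> and the chosen
      \<open>b\<close>, forcing \<open>b = m\<close>.\<close>
    have "x \<in> {b, m}" if "x \<in> set u" for x
    proof (rule ccontr)
      assume neg: "x \<notin> {b, m}"
      then have "x \<in> set u1 \<or> x \<in> set u2" using that u12 by auto
      then have "x < b" using neg lb[of x] rb[of x] by (auto simp: l_def r_def)
      from \<open>x \<in> set u1 \<or> x \<in> set u2\<close> show False
      proof
        assume "x \<in> set u1"
        then obtain v w where "u1 = v @ x # w" by (auto simp: in_set_conv_decomp)
        then have "m = b"
          using \<open>x < b\<close> \<open>b < m\<close> by (intro step[of "pre @ m # v" x "w @ b # r"]) (auto simp: xs3 l_def)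
        then show False using b by simp
      next
        assume "x \<in> set u2"
        then obtain v w where "u2 = v @ x # w" by (auto simp: in_set_conv_decomp)
        then have "b = m"
          using \<open>x < b\<close> \<open>b < m\<close> by (intro step[of "l @ b # v" x "w @ m # suf"]) (auto simp: xs3 r_def)
        then show False using b by simp
      qed
    qed
    then have "mid \<in> dipped b m" using u b_u by (auto simp: dipped_def)
    \<comment> \<open>Here \<open>d\<close> is read off from \<open>length pre = b + d + 1\<close>,
      so the upper bound on \<open>m\<close> in \<open>crests\<close> becomes \<open>m\<close> <=
      \<open>p\<close>.\<close>
    then have "mid \<in> crests b (p - b - 1)"
      using \<open>b < m\<close> \<open>m \<le> p\<close> by (auto simp: crests_def)
    moreover have "b + (p - b - 1) + 1 = p" using \<open>m \<le> p\<close> \<open>b < m\<close> by simp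
    moreover have "pre \<in> rising p (b + 1)"
    proof (rule riseI)
      show "x < b + 1" if "x \<in> set pre" for x
        using lb[of x] pre_less[of x] that by (auto simp: l_def)
    qed
    moreover have "suf \<in> falling (b + 1)"
    proof (rule fallI)
      show "x < b + 1" if "x \<in> set suf" for x
        using rb[of x] suf_less[of x] that by (auto simp: r_def)
    qed
    ultimately have "(b, p - b - 1, pre, mid, suf) \<in> pieces n"
      using lens by (simp only: pieces_def mem_Collect_eq prod.case simp_thms)
    then show ?thesis by (rule rev_image_eqI) (simp add: glue_def xs2)
  qed
qed

lemma zeros_avoid: "replicate n 0 \<in> avoiding_inversion_sequences n {[1, 0, 2], [2, 0, 1]}"
proof -
  have "valleys_flat (replicate n (0 :: nat))"
    unfolding valleys_flat_def
  proof (intro allI impI ballI)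
    fix l b r a c
    assume "replicate n (0 :: nat) = l @ b # r" "a \<in> set l" "c \<in> set r"
    then have "{a, c} \<subseteq> set (replicate n 0)" by simp
    then show "a = c" by (cases n) auto
  qed
  then show ?thesis
    unfolding avoiding_inversion_sequences_def inversion_sequences_def
      valleys_flat_iff_avoids[symmetric] by auto
qed

lemma avoiding_eq:
  "avoiding_inversion_sequences n {[1, 0, 2], [2, 0, 1]} = insert (replicate n 0) (glue ` pieces n)"
  using glue_avoids(1) avoiding_in_glue zeros_avoid by blast

text \<open>The extra one is the zero sequence, which is not cut.\<close>

lemma card_avoiding:
  "card (avoiding_inversion_sequences n {[1, 0, 2], [2, 0, 1]}) = Suc (card (pieces n))"
proof -
  have fin: "finite (glue ` pieces n)"
    by (rule finite_subset[OF _ finite_avoiding_inversion_sequences[of n "{[1, 0, 2], [2, 0, 1]}"]])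
      (use avoiding_eq in blast)
  have "replicate n 0 \<notin> glue ` pieces n"
  proof
    assume "replicate n 0 \<in> glue ` pieces n"
    then obtain s where "s \<in> pieces n" "glue s = replicate n 0" by auto
    with glue_avoids(2,3)[OF this(1)] show False by (cases n) auto
  qed
  with fin show ?thesis
    by (simp add: avoiding_eq card_image inj_on_glue)
qed

section \<open>Locally finite sums of power series\<close>

definition fps_sum :: "(nat \<Rightarrow> 'a::comm_ring_1 fps) \<Rightarrow> 'a fps" where
  "fps_sum f = Abs_fps (\<lambda>n. \<Sum>i\<le>n. f i $ n)"

text \<open>Ensures that the truncated sums in \<open>fps_sum\<close> are the coefficients of the infinite sum.\<close>

definition admissible :: "(nat \<Rightarrow> 'a::comm_ring_1 fps) \<Rightarrow> bool" where
  "admissible f \<longleftrightarrow> (\<forall>i n. n < i \<longrightarrow> f i $ n = 0)"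

lemma fps_sum_nth:
  assumes "admissible f" "n \<le> N"
  shows "fps_sum f $ n = (\<Sum>i\<le>N. f i $ n)"
  unfolding fps_sum_def fps_nth_Abs_fps
  using assms by (intro sum.mono_neutral_left) (auto simp: admissible_def)

lemma fps_sum_add: "fps_sum (\<lambda>i. f i + g i) = fps_sum f + fps_sum g"
  by (simp add: fps_sum_def fps_eq_iff sum.distrib)

lemma admissible_mult: "admissible f \<Longrightarrow> admissible (\<lambda>i. g i * f i)"
  unfolding admissible_def fps_mult_nth by (intro allI impI sum.neutral) auto

lemma admissible_Suc: "admissible f \<Longrightarrow> admissible (\<lambda>i. f (Suc i))"
  by (auto simp: admissible_def)

lemma fps_sum_mult:
  assumes "admissible f"
  shows "c * fps_sum f = fps_sum (\<lambda>i. c * f i)"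
proof (rule fps_ext)
  fix n
  have "(c * fps_sum f) $ n = (\<Sum>k=0..n. c $ k * (\<Sum>i\<le>n. f i $ (n - k)))"
    by (simp add: fps_mult_nth fps_sum_nth[OF assms, of _ n])
  also have "\<dots> = (\<Sum>i\<le>n. \<Sum>k=0..n. c $ k * f i $ (n - k))"
    by (subst sum.swap) (simp add: sum_distrib_left)
  finally show "(c * fps_sum f) $ n = fps_sum (\<lambda>i. c * f i) $ n"
    by (simp add: fps_sum_def fps_mult_nth)
qed

lemma fps_sum_Suc:
  assumes "admissible f"
  shows "fps_sum f = f 0 + fps_sum (\<lambda>i. f (Suc i))"
proof (rule fps_ext)
  fix n
  \<comment> \<open>Admissibility allows one extra term, so that the shifted sum is again truncated
    at \<open>n\<close>.\<close>
  have "fps_sum f $ n = (\<Sum>i\<le>Suc n. f i $ n)" using assms by (rule fps_sum_nth) simp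
  then show "fps_sum f $ n = (f 0 + fps_sum (\<lambda>i. f (Suc i))) $ n"
    by (simp add: fps_sum_def sum.atMost_Suc_shift del: sum.atMost_Suc)
qed

lemma admissible_X_power: "(\<And>i. i \<le> k i) \<Longrightarrow> admissible (\<lambda>i. fps_X ^ k i * f i)"
  unfolding admissible_def fps_X_power_mult_nth by (auto dest: order.strict_trans2)

lemma admissible_power:
  fixes c :: "'a::idom fps"
  assumes "c $ 0 = 0"
  shows "admissible (\<lambda>i. c ^ i)"
  using assms by (auto simp: admissible_def startsby_zero_power_prefix)

lemma fps_sum_geometric:
  fixes c :: "'a::idom fps"
  assumes "c $ 0 = 0"
  shows "(1 - c) * fps_sum (\<lambda>i. c ^ i) = 1"
proof -
  note adm = admissible_power[OF assms]
  have "fps_sum (\<lambda>i. c ^ i) = 1 + c * fps_sum (\<lambda>i. c ^ i)"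
    by (subst fps_sum_Suc[OF adm]) (simp add: fps_sum_mult[OF adm])
  then show ?thesis by (simp add: algebra_simps)
qed

text \<open>The weights \<open>Suc i\<close> arise from the number of possible maxima in
  \<open>crests\<close>. With the plain geometric series this gives the value
  \<open>1/(1 - c)^2\<close>.\<close>

lemma fps_sum_geometric_deriv:
  fixes c :: "'a::idom fps"
  assumes "c $ 0 = 0"
  shows "(1 - c) * fps_sum (\<lambda>i. of_nat (Suc i) * c ^ i) = fps_sum (\<lambda>i. c ^ i)"
proof -
  note adm = admissible_power[OF assms]
  note adm' = admissible_mult[OF adm, of "\<lambda>i. of_nat (Suc i)"]
  have "fps_sum (\<lambda>i. of_nat (Suc i) * c ^ i) =
      1 + fps_sum (\<lambda>i. c * (of_nat (Suc i) * c ^ i) + c * c ^ i)"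
    by (subst fps_sum_Suc[OF adm']) (simp add: algebra_simps)
  also have "\<dots> = 1 + c * fps_sum (\<lambda>i. of_nat (Suc i) * c ^ i) + c * fps_sum (\<lambda>i. c ^ i)"
    by (simp add: fps_sum_add fps_sum_mult[OF adm] fps_sum_mult[OF adm'] del: of_nat_Suc)
  finally have "(1 - c) * fps_sum (\<lambda>i. of_nat (Suc i) * c ^ i) = 1 + c * fps_sum (\<lambda>i. c ^ i)"
    by (simp add: algebra_simps del: of_nat_Suc)
  also have "\<dots> = fps_sum (\<lambda>i. c ^ i)"
    using fps_sum_geometric[OF assms] by (simp add: algebra_simps)
  finally show ?thesis .
qed

section \<open>Generating functions of the parts\<close>

text \<open>Since \<open>card\<close> is 0 on infinite sets, the coefficients are meaningful only
  for finite fibres; hence the finiteness lemmas below.\<close>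

definition size_gf :: "('a \<Rightarrow> nat) \<Rightarrow> 'a set \<Rightarrow> real fps" where
  "size_gf f A = Abs_fps (\<lambda>n. of_nat (card {x \<in> A. f x = n}))"

lemma fibre_Times:
  "{t \<in> A \<times> B. (case t of (x, y) \<Rightarrow> f x + g y) = n} =
    (\<Union>i\<in>{0..n}. {x \<in> A. f x = i} \<times> {y \<in> B. g y = n - i})" for n :: nat
  by fastforce

lemma finite_fibre_Times:
  assumes "\<And>n. finite {x \<in> A. f x = n}" "\<And>n. finite {y \<in> B. g y = n}"
  shows "finite {t \<in> A \<times> B. (case t of (x, y) \<Rightarrow> f x + g y) = (n :: nat)}"
  unfolding fibre_Times using assms by blast

lemma size_gf_Times:
  assumes "\<And>n. finite {x \<in> A. f x = n}" "\<And>n. finite {y \<in> B. g y = n}"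
  shows "size_gf (\<lambda>(x, y). f x + g y) (A \<times> B) = size_gf f A * size_gf g B"
proof (rule fps_ext)
  fix n
  have "card (\<Union>i\<in>{0..n}. {x \<in> A. f x = i} \<times> {y \<in> B. g y = n - i}) =
      (\<Sum>i=0..n. card ({x \<in> A. f x = i} \<times> {y \<in> B. g y = n - i}))"
    using assms by (intro card_UN_disjoint) auto
  then show "size_gf (\<lambda>(x, y). f x + g y) (A \<times> B) $ n = (size_gf f A * size_gf g B) $ n"
    unfolding size_gf_def fps_nth_Abs_fps fibre_Times fps_mult_nth
    by (simp add: card_cartesian_product)
qed

lemma finite_length_fibre:
  assumes "\<And>xs. xs \<in> A \<Longrightarrow> set xs \<subseteq> S" "finite S"
  shows "finite {xs \<in> A. length xs = n}"
  by (rule finite_subset[OF _ finite_lists_length_eq[OF assms(2), of n]]) (use assms(1) in auto)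

lemma finite_rising_fibre: "finite {xs \<in> rising p w. length xs = n}"
  by (rule finite_length_fibre[of _ "{..<w}"]) (auto simp: rising_def)

lemma finite_rising: "finite (rising p w)"
  by (rule finite_subset[OF _ finite_rising_fibre[of p w p]]) (auto simp: rising_def)

lemma finite_falling_fibre: "finite {xs \<in> falling w. length xs = n}"
  by (rule finite_length_fibre[of _ "{..<w}"]) (auto simp: falling_def)

lemma finite_crests_fibre: "finite {xs \<in> crests b d. length xs = n}"
  by (rule finite_length_fibre[of _ "{..b+d+1}"]) (fastforce elim!: crestsE)+

lemma size_gf_rising: "size_gf length (rising p w) = of_nat (card (rising p w)) * fps_X ^ p"
proof (rule fps_ext)
  fix n
  have "{xs \<in> rising p w. length xs = n} = (if n = p then rising p w else {})"
    by (auto simp: rising_def)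
  then show "size_gf length (rising p w) $ n = (of_nat (card (rising p w)) * fps_X ^ p) $ n"
    by (simp add: size_gf_def fps_of_nat[symmetric])
qed

text \<open>A weakly decreasing list bounded by \<open>w\<close> either begins with
  \<open>w\<close>, which can be stripped, or stays below \<open>w\<close>.\<close>

lemma size_gf_falling_Suc:
  "size_gf length (falling (Suc w)) = size_gf length (falling w) + fps_X * size_gf length (falling (Suc w))"
proof (rule fps_ext)
  fix n
  have *: "{xs \<in> falling (Suc w). length xs = n} = {xs \<in> falling w. length xs = n} \<union>
      (case n of 0 \<Rightarrow> {} | Suc k \<Rightarrow> (#) w ` {xs \<in> falling (Suc w). length xs = k})" (is "?L = ?A \<union> ?B")
  proof
    show "?L \<subseteq> ?A \<union> ?B"
    proof
      fix xs assume xs: "xs \<in> ?L"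
      show "xs \<in> ?A \<union> ?B"
      proof (cases xs)
        case Nil
        then show ?thesis using xs by (auto simp: falling_def)
      next
        case (Cons y ys)
        then show ?thesis using xs by (cases "y = w") (fastforce simp: falling_def)+
      qed
    qed
    show "?A \<union> ?B \<subseteq> ?L"
      by (auto simp: falling_def less_Suc_eq_le intro: less_imp_le split: nat.splits)
  qed
  have "card ?L = card ?A + card ?B"
    unfolding * using finite_falling_fibre
    by (intro card_Un_disjoint) (auto simp: falling_def split: nat.splits)
  then show "size_gf length (falling (Suc w)) $ n =
      (size_gf length (falling w) + fps_X * size_gf length (falling (Suc w))) $ n"
    by (cases n) (simp_all add: size_gf_def card_image)
qed

lemma size_gf_falling: "size_gf length (falling w) = inverse (1 - fps_X) ^ w"
proof (induction w)
  case 0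
  have "{xs \<in> falling 0. length xs = n} = (if n = 0 then {[]} else {})" for n
    by (auto simp: falling_def)
  then show ?case by (simp add: size_gf_def fps_eq_iff)
next
  case (Suc w)
  have "(1 - fps_X) * size_gf length (falling (Suc w)) = size_gf length (falling w)"
    using size_gf_falling_Suc[of w] by (simp add: algebra_simps)
  then have "inverse (1 - fps_X) * (1 - fps_X) * size_gf length (falling (Suc w)) =
      inverse (1 - fps_X) ^ Suc w"
    by (simp add: Suc mult.assoc)
  then show ?case by (simp add: inverse_mult_eq_1)
qed

text \<open>Among the two-letter words between the two outer \<open>m\<close>, only the constant
  word \<open>m\<close> lacks \<open>b\<close>.\<close>

lemma card_dipped_fibre:
  assumes "b \<noteq> m"
  shows "card {xs \<in> dipped b m. length xs = n} = (if 2 \<le> n then 2 ^ (n - 2) - 1 else 0)"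
proof (cases "2 \<le> n")
  case True
  let ?U = "\<lambda>S. {u. set u \<subseteq> S \<and> length u = n - 2}"
  have "{xs \<in> dipped b m. length xs = n} = (\<lambda>u. m # u @ [m]) ` (?U {b, m} - ?U {m})"
    using True assms by (auto simp: dipped_def image_iff)
  then have "card {xs \<in> dipped b m. length xs = n} = card (?U {b, m} - ?U {m})"
    by (simp add: card_image inj_on_def)
  also have "\<dots> = card (?U {b, m}) - card (?U {m})"
    by (intro card_Diff_subset finite_lists_length_eq) auto
  finally show ?thesis using assms True by (simp add: card_lists_length_eq numeral_2_eq_2)
next
  case False
  then have "{xs \<in> dipped b m. length xs = n} = {}" by (auto simp: dipped_def)
  then show ?thesis using False by (simp only: card.empty if_False)
qed

text \<open>The common size series of all \<open>dipped b m\<close> with distinct \<open>b\<close>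
  and \<open>m\<close>.\<close>

definition dip_gf :: "real fps" where
  "dip_gf = Abs_fps (\<lambda>n. if 2 \<le> n then 2 ^ (n - 2) - 1 else 0)"

lemma fps_geometric_const: "(1 - fps_const a * fps_X) * Abs_fps (\<lambda>n. a ^ n) = (1 :: 'a::comm_ring_1 fps)"
proof (rule fps_ext)
  fix n
  show "((1 - fps_const a * fps_X) * Abs_fps (\<lambda>n. a ^ n)) $ n = (1 :: 'a fps) $ n"
    by (cases n) (simp_all add: left_diff_distrib mult.assoc)
qed

lemma inverse_one_minus_X: "inverse (1 - fps_X) = Abs_fps (\<lambda>_. 1 :: 'a::field)"
  using fps_geometric_const[of "1 :: 'a"] by (intro fps_inverse_unique) simp

text \<open>Up to the factor \<open>fps_X ^ 2\<close>, \<open>dip_gf\<close> is the difference of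
  the geometric series with ratios 2 and 1.\<close>

lemma dip_gf_eq: "(1 - 2 * fps_X) * (1 - fps_X) * dip_gf = fps_X ^ 3"
proof -
  define P Q :: "real fps" where "P = Abs_fps (\<lambda>n. 2 ^ n)" and "Q = Abs_fps (\<lambda>n. 1 ^ n)"
  have "(1 - 2 * fps_X) * P = 1" "(1 - fps_X) * Q = 1"
    using fps_geometric_const[of "2 :: real"] fps_geometric_const[of "1 :: real"]
    by (simp_all add: P_def Q_def numeral_fps_const)
  moreover have "dip_gf = fps_X ^ 2 * (P - Q)"
    by (simp add: fps_eq_iff dip_gf_def P_def Q_def fps_X_power_mult_nth)
  ultimately show ?thesis by algebra
qed

text \<open>The constant middles give the first summand. Each of the \<open>Suc d\<close> values of
  \<open>m\<close> adds one \<open>dip_gf\<close>; these families are told apart by their first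
  entry.\<close>

lemma size_gf_crests:
  "size_gf length (crests b d) = fps_X * inverse (1 - fps_X) + of_nat (Suc d) * dip_gf"
proof (rule fps_ext)
  fix n
  let ?R = "{xs. \<exists>k. xs = replicate (Suc k) (Suc b) \<and> length xs = n}"
  let ?D = "\<lambda>m. {xs \<in> dipped b m. length xs = n}"
  have eq: "{xs \<in> crests b d. length xs = n} = ?R \<union> (\<Union>m\<in>{b+1..b+d+1}. ?D m)"
    by (auto simp: crests_def)
  have R: "?R = (if n = 0 then {} else {replicate n (Suc b)})"
    by (cases n) auto
  have fin: "finite (?D m)" for m
    by (rule finite_length_fibre[of _ "{b, m}"]) (auto simp: dipped_def)
  have "card (?R \<union> (\<Union>m\<in>{b+1..b+d+1}. ?D m)) = card ?R + card (\<Union>m\<in>{b+1..b+d+1}. ?D m)"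
  proof (intro card_Un_disjoint)
    show "finite ?R" unfolding R by simp
    show "finite (\<Union>m\<in>{b+1..b+d+1}. ?D m)" using fin by blast
    have "b \<notin> set xs" if "xs \<in> ?R" for xs using that by (auto split: if_splits)
    moreover have "b \<in> set xs" if "xs \<in> ?D m" for xs m using that by (auto simp: dipped_def)
    ultimately show "?R \<inter> (\<Union>m\<in>{b+1..b+d+1}. ?D m) = {}" by blast
  qed
  also have "card (\<Union>m\<in>{b+1..b+d+1}. ?D m) = (\<Sum>m\<in>{b+1..b+d+1}. card (?D m))"
    using fin by (intro card_UN_disjoint) (auto simp: dipped_def)
  also have "\<dots> = (\<Sum>m\<in>{b+1..b+d+1}. if 2 \<le> n then 2 ^ (n - 2) - 1 else 0)"
    by (intro sum.cong refl card_dipped_fibre) auto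
  also have "\<dots> = Suc d * (if 2 \<le> n then 2 ^ (n - 2) - 1 else 0)" by simp
  also have "card ?R = (if n = 0 then 0 else 1)" unfolding R by simp
  finally have "card {xs \<in> crests b d. length xs = n} =
      (if n = 0 then 0 else 1) + Suc d * (if 2 \<le> n then 2 ^ (n - 2) - 1 else 0)"
    unfolding eq .
  then have "size_gf length (crests b d) $ n = (if n = 0 then 0 else 1) + real (Suc d) * dip_gf $ n"
    by (simp add: size_gf_def dip_gf_def of_nat_diff algebra_simps)
  then show "size_gf length (crests b d) $ n =
      (fps_X * inverse (1 - fps_X) + of_nat (Suc d) * dip_gf) $ n"
    by (simp add: inverse_one_minus_X fps_of_nat[symmetric] del: of_nat_Suc)
qed

section \<open>Ballot recurrence for the first parts\<close>

lemma rising_0: "rising 0 w = {[]}"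
  by (auto simp: rising_def)

lemma rising_Suc_0: "rising (Suc p) 0 = {}"
  by (auto simp: rising_def)

text \<open>The inversion condition alone bounds the entries by \<open>p\<close>. This is the
  boundary case behind \<open>gap_gf_0\<close>.\<close>

lemma rising_Suc_Suc_eq: "rising (Suc p) (Suc (Suc p)) = rising (Suc p) (Suc p)"
proof -
  have "x < Suc p" if "length xs = Suc p" "\<forall>i<Suc p. xs ! i \<le> i" "x \<in> set xs" for x and xs :: "nat list"
    using that by (fastforce simp: in_set_conv_nth)
  then show ?thesis by (fastforce simp: rising_def)
qed

text \<open>By sortedness, either the last entry is \<open>w\<close> and can be removed, or all
  entries are below \<open>w\<close>. The hypothesis makes \<open>w\<close> legal at position
  \<open>p\<close>.\<close>

lemma card_rising_Suc_Suc:
  assumes "w \<le> p"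
  shows "card (rising (Suc p) (Suc w)) = card (rising (Suc p) w) + card (rising p (Suc w))"
proof -
  have *: "rising (Suc p) (Suc w) = rising (Suc p) w \<union> (\<lambda>xs. xs @ [w]) ` rising p (Suc w)"
    (is "?L = ?A \<union> ?B")
  proof
    show "?L \<subseteq> ?A \<union> ?B"
    proof
      fix xs assume xs: "xs \<in> ?L"
      then have "length xs = Suc p" by (simp add: rising_def)
      then obtain ys y where ys: "xs = ys @ [y]" "length ys = p" by (auto simp: length_Suc_conv_rev)
      have 1: "sorted ys" "\<forall>x\<in>set ys. x \<le> y" "y \<le> w" "\<forall>x\<in>set ys. x \<le> w"
        using xs by (auto simp: ys rising_def sorted_append)
      have 2: "xs ! i \<le> i" if "i < Suc p" for i
        using xs that by (simp add: rising_def)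
      have "ys ! i \<le> i" if "i < p" for i
        using 2[of i] that ys by (simp add: nth_append)
      then have B: "ys \<in> rising p (Suc w)" using 1 ys by (auto simp: rising_def)
      show "xs \<in> ?A \<union> ?B"
      proof (cases "y = w")
        case True
        then show ?thesis using B ys by simp
      next
        case False
        then have "\<forall>x\<in>set xs. x < w" using 1 ys by fastforce
        then show ?thesis using xs by (simp add: rising_def)
      qed
    qed
    have "ys @ [w] \<in> ?L" if "ys \<in> rising p (Suc w)" for ys
    proof -
      have "(ys @ [w]) ! i \<le> i" if "i < Suc p" for i
        using that \<open>ys \<in> _\<close> assms by (cases "i = p") (auto simp: rising_def nth_append)
      then show ?thesis using that by (auto simp: rising_def sorted_append less_Suc_eq_le)
    qed
    then show "?A \<union> ?B \<subseteq> ?L" by (auto simp: rising_def less_Suc_eq)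
  qed
  have "card ?L = card ?A + card ?B"
    unfolding * using finite_rising by (intro card_Un_disjoint) (auto simp: rising_def)
  then show ?thesis by (simp add: card_image inj_on_def)
qed

section \<open>The kernel recurrence\<close>

text \<open>The pieces need only \<open>gap_gf (Suc d)\<close>, times the one factor
  \<open>inverse (1 - fps_X)\<close> by which \<open>falling (b + 1)\<close> exceeds the power used
  here. Index 0 is added to close the recurrence.\<close>

definition gap_gf :: "nat \<Rightarrow> real fps" where
  "gap_gf d = fps_sum (\<lambda>b. fps_X ^ (b + d) *
     (of_nat (card (rising (b + d) (b + 1))) * inverse (1 - fps_X) ^ b))"

lemma admissible_gap:
  "admissible (\<lambda>b. fps_X ^ (b + d) *
     (of_nat (card (rising (b + d) (b + 1))) * inverse (1 - fps_X :: real fps) ^ b))"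
  by (rule admissible_X_power) simp

lemma gap_gf_0: "gap_gf 0 = 1 + inverse (1 - fps_X) * gap_gf 1"
proof -
  have "gap_gf 0 = 1 + fps_sum (\<lambda>b. inverse (1 - fps_X) * (fps_X ^ (b + 1) *
     (of_nat (card (rising (b + 1) (b + 1))) * inverse (1 - fps_X) ^ b)))"
    unfolding gap_gf_def
    by (subst fps_sum_Suc[OF admissible_gap]) (simp add: rising_0 rising_Suc_Suc_eq mult_ac)
  also have "\<dots> = 1 + inverse (1 - fps_X) * gap_gf 1"
    unfolding gap_gf_def by (subst fps_sum_mult[OF admissible_gap]) (rule refl)
  finally show ?thesis .
qed

text \<open>Lowering the value bound at fixed length trades one unit of \<open>b\<close> for one of
  \<open>d\<close> and costs a factor \<open>inverse (1 - fps_X)\<close>. Removing the last entry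
  lowers \<open>d\<close> and costs \<open>fps_X\<close>.\<close>

lemma gap_gf_Suc:
  "gap_gf (Suc d) = inverse (1 - fps_X) * gap_gf (Suc (Suc d)) + fps_X * gap_gf d"
proof -
  let ?y = "inverse (1 - fps_X) :: real fps"
  let ?f = "\<lambda>d b. fps_X ^ (b + d) * (of_nat (card (rising (b + d) (b + 1))) * ?y ^ b)"
  have "gap_gf (Suc d) = ?f (Suc d) 0 + fps_sum (\<lambda>b. ?f (Suc d) (Suc b))"
    unfolding gap_gf_def by (rule fps_sum_Suc[OF admissible_gap])
  \<comment> \<open>For \<open>b = 0\<close> the bound cannot be lowered, so only the removal of the
    last entry remains.\<close>
  also have "?f (Suc d) 0 = fps_X * ?f d 0"
    using card_rising_Suc_Suc[of 0 d] by (simp add: rising_Suc_0)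
  also have "(\<lambda>b. ?f (Suc d) (Suc b)) = (\<lambda>b. ?y * ?f (Suc (Suc d)) b + fps_X * ?f d (Suc b))"
  proof
    fix b
    show "?f (Suc d) (Suc b) = ?y * ?f (Suc (Suc d)) b + fps_X * ?f d (Suc b)"
      using card_rising_Suc_Suc[of "Suc b" "Suc (b + d)"] by (simp add: algebra_simps)
  qed
  also have "fps_sum \<dots> = ?y * gap_gf (Suc (Suc d)) + fps_X * fps_sum (\<lambda>b. ?f d (Suc b))"
    unfolding fps_sum_add gap_gf_def
    by (simp only: fps_sum_mult[OF admissible_gap] fps_sum_mult[OF admissible_Suc[OF admissible_gap]])
  also have "fps_sum (\<lambda>b. ?f d (Suc b)) = gap_gf d - ?f d 0"
    unfolding gap_gf_def using fps_sum_Suc[OF admissible_gap, of d] by simp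
  finally show ?thesis by (simp add: algebra_simps)
qed

lemma gap_gf_nth_small: "n < d \<Longrightarrow> gap_gf d $ n = 0"
  by (simp add: gap_gf_def fps_sum_def fps_X_power_mult_nth)

text \<open>
  The recurrence runs towards larger \<open>d\<close>; it still has at most one solution because
  \<open>E d\<close> vanishes below degree \<open>d\<close>.
\<close>

lemma gap_recurrence_zero:
  fixes E :: "nat \<Rightarrow> 'a::comm_ring_1 fps"
  assumes E0: "E 0 = y * E 1" and ESuc: "\<And>d. E (Suc d) = y * E (Suc (Suc d)) + fps_X * E d"
    and small: "\<And>d n. n < d \<Longrightarrow> E d $ n = 0"
  shows "E d = 0"
proof -
  have "E d $ n = 0" for n d
  proof (induction n arbitrary: d rule: less_induct)
    case (less n)
    show ?case
    \<comment> \<open>Since \<open>y\<close> may have a nonzero constant term, coefficient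
      \<open>n\<close> of \<open>E d\<close> depends on coefficient \<open>n\<close> of
      \<open>E (Suc d)\<close>. The inner induction therefore descends from \<open>d\<close> >
      \<open>n\<close>.\<close>
    proof (induction "Suc n - d" arbitrary: d)
      case 0
      then show ?case by (intro small) simp
    next
      case (Suc k)
      have "E (Suc d) $ i = 0" if "i \<le> n" for i
        using that less[of i] Suc(1)[of "Suc d"] Suc(2) by (cases "i = n") auto
      then have y: "(y * E (Suc d)) $ n = 0" by (simp add: fps_mult_nth)
      have X: "(fps_X * E e) $ n = 0" for e using less[of "n - 1" e] by simp
      show ?case
      proof (cases d)
        case 0
        then show ?thesis using E0 y by simp
      next
        case (Suc e)
        then show ?thesis
          using ESuc[of e] y X[of e] by simp
      qed
    qed
  qed
  then show ?thesis by (simp add: fps_eq_iff)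
qed

text \<open>The powers of \<open>c\<close> satisfy the recurrence multiplied by
  \<open>fps_X\<close>: each instance is a power of \<open>c\<close> times the equation for
  \<open>c\<close>. Uniqueness is applied to the difference.\<close>

lemma gap_gf_eq:
  assumes c0: "c $ 0 = 0" and c: "c = fps_X + inverse (1 - fps_X) * c\<^sup>2"
  shows "fps_X * gap_gf d = c ^ Suc d"
proof -
  define y :: "real fps" where "y = inverse (1 - fps_X)"
  let ?E = "\<lambda>d. fps_X * gap_gf d - c ^ Suc d"
  have "?E d = 0"
  proof (rule gap_recurrence_zero[where E = ?E and y = y])
    show "?E 0 = y * ?E 1"
      using c gap_gf_0 unfolding y_def[symmetric] power_one_right power_Suc power_0 One_nat_def
      by algebra
    show "?E (Suc d) = y * ?E (Suc (Suc d)) + fps_X * ?E d" for d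
    proof -
      define p where "p = c ^ d"
      show ?thesis
        using c gap_gf_Suc[of d] unfolding y_def[symmetric] power_Suc p_def[symmetric] by algebra
    qed
    show "?E d $ n = 0" if "n < d" for d n
      using that gap_gf_nth_small[of "n - 1" d] admissible_power[OF c0]
      by (auto simp: admissible_def simp del: power_Suc)
  qed
  then show ?thesis by simp
qed

section \<open>Summation over the pieces and the closed form\<close>

lemma card_pieces:
  "of_nat (card (pieces n)) = fps_sum (\<lambda>d. inverse (1 - fps_X) *
     (fps_X * inverse (1 - fps_X) + of_nat (Suc d) * dip_gf) * gap_gf (Suc d)) $ n"
proof -
  let ?y = "inverse (1 - fps_X) :: real fps"
  let ?M = "\<lambda>d. fps_X * ?y + of_nat (Suc d) * dip_gf"
  let ?f = "\<lambda>d b. fps_X ^ (b + d) * (of_nat (card (rising (b + d) (b + 1))) * ?y ^ b)"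
  define sz :: "nat list \<times> nat list \<times> nat list \<Rightarrow> nat" where
    "sz = (\<lambda>(x, t). length x + (case t of (y, z) \<Rightarrow> length y + length z))"
  define T where "T = (\<lambda>b d. rising (b + d + 1) (b + 1) \<times> crests b d \<times> falling (b + 1))"
  have fin: "finite {t \<in> T b d. sz t = n}" for b d
    unfolding T_def sz_def
    by (intro finite_fibre_Times finite_rising_fibre finite_crests_fibre finite_falling_fibre)
  have gf: "size_gf sz (T b d) = ?y * ?M d * ?f (Suc d) b" for b d
    unfolding T_def sz_def
    by (simp add: size_gf_Times finite_fibre_Times finite_rising_fibre finite_crests_fibre
          finite_falling_fibre size_gf_rising size_gf_crests size_gf_falling mult_ac
          del: of_nat_Suc)
  \<comment> \<open>Both indices are at most \<open>n\<close> because \<open>pre\<close> has length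
    \<open>b + d + 1\<close>.\<close>
  have "pieces n = (SIGMA b:{..n}. SIGMA d:{..n}. {t \<in> T b d. sz t = n})"
    by (auto simp: pieces_def T_def sz_def rising_def)
  then have "card (pieces n) = (\<Sum>b\<le>n. \<Sum>d\<le>n. card {t \<in> T b d. sz t = n})"
    using fin by (simp add: card_SigmaI)
  then have "of_nat (card (pieces n)) = (\<Sum>b\<le>n. \<Sum>d\<le>n. size_gf sz (T b d) $ n)"
    by (simp add: size_gf_def)
  \<comment> \<open>Summing over \<open>b\<close> first lets the middle factor, which depends on
    \<open>d\<close> only, be pulled out.\<close>
  also have "\<dots> = (\<Sum>d\<le>n. \<Sum>b\<le>n. (?y * ?M d * ?f (Suc d) b) $ n)"
    unfolding gf by (rule sum.swap)
  also have "\<dots> = (\<Sum>d\<le>n. fps_sum (\<lambda>b. ?y * ?M d * ?f (Suc d) b) $ n)"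
    by (simp add: fps_sum_def del: of_nat_Suc)
  also have "\<dots> = (\<Sum>d\<le>n. (?y * ?M d * gap_gf (Suc d)) $ n)"
    unfolding gap_gf_def fps_sum_mult[OF admissible_gap] by (rule refl)
  finally show ?thesis by (simp only: fps_sum_def fps_nth_Abs_fps)
qed

lemma avoiding_gf_eq:
  "avoiding_gf {[1, 0, 2], [2, 0, 1]} = inverse (1 - fps_X) + fps_sum (\<lambda>d. inverse (1 - fps_X) *
     (fps_X * inverse (1 - fps_X) + of_nat (Suc d) * dip_gf) * gap_gf (Suc d))"
proof -
  have "avoiding_gf {[1, 0, 2], [2, 0, 1]} =
      inverse (1 - fps_X) + Abs_fps (\<lambda>n. of_nat (card (pieces n)))"
    by (simp add: fps_eq_iff avoiding_gf_def card_avoiding inverse_one_minus_X)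
  then show ?thesis
    by (simp only: card_pieces fps_nth_inverse)
qed

theorem theorem24:
  shows "fps_to_fls (avoiding_gf {[1, 0, 2], [2, 0, 1]}) =
    fps_to_fls
      (- 8 * fps_X ^ 4 + 18 * fps_X ^ 3 - 10 * fps_X ^ 2 - 8 * fps_X + 4
        + 2 * (2 * fps_X - 1) * (fps_X ^ 2 - 2 * fps_X + 2)
          * fps_sqrt ((5 * fps_X - 1) * (fps_X - 1)))
    / fps_to_fls (4 * fps_X * (2 * fps_X - 1) * (fps_X - 1) * (fps_X - 2) ^ 2)"
proof -
  define F where "F = avoiding_gf {[1, 0, 2], [2, 0, 1]}"
  define x where "x = (fps_X :: real fps)"
  define y where "y = inverse (1 - x)"
  define s where "s = fps_sqrt ((5 * x - 1) * (x - 1))"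
  have "((5 * x - 1) * (x - 1)) $ 0 = 1" by (simp add: x_def)
  from fps_sqrt_power2[OF this] have s2: "s\<^sup>2 = (5 * x - 1) * (x - 1)" and s0: "s $ 0 = 1"
    by (simp_all add: s_def)
  have y: "(1 - x) * y = 1" unfolding y_def by (rule inverse_mult_eq_1') (simp add: x_def)
  \<comment> \<open>The root of the kernel quadratic with constant term 0.\<close>
  define c where "c = fps_const (1 / 2) * (1 - x - s)"
  have c0: "c $ 0 = 0" by (simp add: c_def s0 x_def)
  have "2 * c = 1 - x - s"
    by (simp add: c_def numeral_fps_const mult.assoc[symmetric])
  then have s: "s = 1 - x - 2 * c" by simp
  then have "4 * (c\<^sup>2 - (1 - x) * c + x * (1 - x)) = 0" using s2 by algebra
  then have "c\<^sup>2 - (1 - x) * c + x * (1 - x) = 0"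
    by (metis mult_eq_0_iff zero_neq_numeral)
  then have cc: "c\<^sup>2 = (1 - x) * c - x * (1 - x)" by algebra
  then have yc: "y * c\<^sup>2 = c - x" using y by algebra
  define S where "S = fps_sum (\<lambda>i. c ^ i)"
  define S' where "S' = fps_sum (\<lambda>i. of_nat (Suc i) * c ^ i)"
  have S: "(1 - c) * S = 1" unfolding S_def using c0 by (rule fps_sum_geometric)
  have S': "(1 - c) * S' = S" unfolding S_def S'_def using c0 by (rule fps_sum_geometric_deriv)
  have gap: "x * gap_gf d = c ^ Suc d" for d
    unfolding x_def by (rule gap_gf_eq[OF c0]) (use yc in \<open>simp add: y_def x_def\<close>)
  have adm: "admissible (\<lambda>d. y * (x * y + of_nat (Suc d) * dip_gf) * gap_gf (Suc d))"
    using gap_gf_nth_small by (intro admissible_mult) (auto simp: admissible_def)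
  \<comment> \<open>The factor \<open>x\<close> is there because \<open>gap\<close> evaluates
    \<open>x * gap_gf d\<close>.\<close>
  have "x * F = x * y + x * fps_sum (\<lambda>d. y * (x * y + of_nat (Suc d) * dip_gf) * gap_gf (Suc d))"
    unfolding F_def avoiding_gf_eq by (simp add: x_def y_def distrib_left)
  also have "x * fps_sum (\<lambda>d. y * (x * y + of_nat (Suc d) * dip_gf) * gap_gf (Suc d)) =
      fps_sum (\<lambda>d. y * (x * y + of_nat (Suc d) * dip_gf) * (x * gap_gf (Suc d)))"
    unfolding fps_sum_mult[OF adm] by (simp only: mult_ac)
  also have "\<dots> = fps_sum (\<lambda>d. (y * c\<^sup>2 * x * y) * c ^ d + (y * c\<^sup>2 * dip_gf) * (of_nat (Suc d) * c ^ d))"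
    unfolding gap by (simp add: algebra_simps power2_eq_square del: of_nat_Suc)
  also have "\<dots> = y * c\<^sup>2 * x * y * S + y * c\<^sup>2 * dip_gf * S'"
    unfolding S_def S'_def fps_sum_add
    by (simp only: fps_sum_mult[OF admissible_power[OF c0]]
          fps_sum_mult[OF admissible_mult[OF admissible_power[OF c0]]])
  finally have xF: "x * F = x * y + (c - x) * x * y * S + (c - x) * dip_gf * S'"
    unfolding yc by (simp add: mult.assoc)
  have K: "(2 * x - 1) * (x - 1) * dip_gf = x ^ 3"
    using dip_gf_eq unfolding x_def[symmetric] by algebra
  \<comment> \<open>This inverts \<open>1 - c\<close> up to a polynomial in \<open>x\<close>, so
    \<open>S\<close> and \<open>S'\<close> become polynomial in \<open>c\<close>; it is the source
    of \<open>(x - 2) ^ 2\<close> in the denominator.\<close>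
  have "(1 - c) * (c + x) = x * (2 - x)" using cc by algebra
  then have S_eq: "x * (2 - x) * S = c + x" and S'_eq: "x ^ 2 * (2 - x) ^ 2 * S' = (c + x)\<^sup>2"
    using S S' by algebra+
  define D where "D = 4 * x * (2 * x - 1) * (x - 1) * (x - 2) ^ 2"
  define N where "N = - 8 * x ^ 4 + 18 * x ^ 3 - 10 * x ^ 2 - 8 * x + 4
        + 2 * (2 * x - 1) * (x ^ 2 - 2 * x + 2) * s"
  \<comment> \<open>The factors of \<open>D\<close> are grouped with what they clear:
    \<open>x - 1\<close> with \<open>y\<close>, \<open>(2 * x - 1) * (x - 1)\<close> with
    \<open>dip_gf\<close>, and powers of \<open>x\<close> and \<open>x - 2\<close> with
    \<open>S\<close> and \<open>S'\<close>.\<close>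
  have "x * (F * D) = 4 * x * (2 * x - 1) * (x - 2) ^ 2 * ((x - 1) * (x * y + (c - x) * x * y * S))
      + 4 * x * (x - 2) ^ 2 * (c - x) * ((2 * x - 1) * (x - 1) * dip_gf) * S'"
    using xF unfolding D_def by algebra
  also have "(x - 1) * (x * y + (c - x) * x * y * S) = - (x + (c - x) * (x * S))"
    using y by algebra
  also have "4 * x * (2 * x - 1) * (x - 2) ^ 2 * - (x + (c - x) * (x * S)) =
      - 4 * x * (2 * x - 1) * ((x - 2) ^ 2 * x + (2 - x) * (c - x) * (c + x))"
    using S_eq by algebra
  also have "4 * x * (x - 2) ^ 2 * (c - x) * ((2 * x - 1) * (x - 1) * dip_gf) * S' =
      4 * x ^ 2 * (c - x) * (c + x)\<^sup>2"
    unfolding K using S'_eq by algebra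
  \<comment> \<open>Reducing modulo the quadratic for \<open>c\<close> leaves an expression linear
    in \<open>c\<close>, hence in \<open>s\<close>.\<close>
  also have "- 4 * x * (2 * x - 1) * ((x - 2) ^ 2 * x + (2 - x) * (c - x) * (c + x)) +
      4 * x ^ 2 * (c - x) * (c + x)\<^sup>2 = x * N"
    unfolding N_def s using cc by algebra
  finally have "F * D = N" by (simp add: x_def)
  moreover have "D \<noteq> 0"
  proof -
    have "(2 * x - 1) $ 0 \<noteq> 0" "(x - 1) $ 0 \<noteq> 0" "(x - 2) $ 0 \<noteq> 0" "x \<noteq> 0"
      by (simp_all add: x_def)
    then have "2 * x - 1 \<noteq> 0" "x - 1 \<noteq> 0" "x - 2 \<noteq> 0" "x \<noteq> 0"
      by (metis fps_zero_nth)+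
    then show ?thesis by (simp add: D_def)
  qed
  \<comment> \<open>\<open>D\<close> has constant term 0 and is no unit among power series; in the
    field of Laurent series \<open>D\<close> being nonzero suffices.\<close>
  ultimately have "fps_to_fls F = fps_to_fls N / fps_to_fls D"
    by (simp add: eq_divide_eq fls_times_fps_to_fls[symmetric])
  then show ?thesis by (simp only: F_def N_def D_def s_def x_def)
qed

end
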